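(* The finite Hilbert transform $T_{\log}\colon L\log L\to L^1$ is not order bounded.
   Context: $\mu$ is Lebesgue measure on the Borel $\sigma$-algebra $\mathcal B$ of $(-1,1)$, $L^0$ is the space of (a.e.-equivalence classes of) $\mathbb C$-valued measurable functions on $(-1,1)$, and $L^1=L^1(\mu)$. The finite Hilbert transform of $f\in L^1$ is $T(f)(t):=\lim_{\varepsilon\to0^+}\frac1\pi\left(\int_{-1}^{t-\varepsilon}+\int_{t+\varepsilon}^1\right)\frac{f(x)}{x-t}\,dx$, which exists for a.e. $t\in(-1,1)$ and is measurable. For $f\in L^0$, $f^*$ is the decreasing rearrangement (the right-continuous inverse of the distribution function $\lambda\mapsto\mu(\{|f|>\lambda\})$). $L\log L$ is the space of all $f\in L^0$ with $\|f\|_{L\log L}:=\int_0^2 f^*(t)\log(2e/t)\,dt<\infty$, equipped with this norm (equivalently, $\int_{-1}^1|f|\log^+|f|\,dx<\infty$). It is known that $T$ maps $L\log L$ boundedly into $L^1$; $T_{\log}\colon L\log L\to L^1$ denotes the resulting operator. A subset $F$ of $L\log L$ (resp. $L^1$) is order bounded if there is $0\le h$ in $L\log L$ (resp. in $L^1$) with $|f|\le h$ a.e. for all $f\in F$. A linear operator is order bounded if it maps order bounded sets to order bounded sets. *)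

theory Defs
  imports "HOL-Analysis.Analysis"
begin

text \<open>Elements of the function spaces are represented by measurable functions rather than by
  a.e.-equivalence classes; all notions below depend on the functions only up to null sets.\<close>

definition \<mu> :: "real measure" where
  "\<mu> = restrict_space lborel {-1<..<1}"

definition L1 :: "(real \<Rightarrow> complex) set" where
  "L1 = {f. integrable \<mu> f}"

definition distribution_function :: "(real \<Rightarrow> complex) \<Rightarrow> real \<Rightarrow> real" where
  "distribution_function f s = measure \<mu> {x \<in> space \<mu>. s < cmod (f x)}"

text \<open>Since \<^term>\<open>\<mu>\<close> is finite, for measurable \<^term>\<open>f\<close> and \<^term>\<open>t > 0\<close> the infimum is over a
  nonempty set. The value at \<^term>\<open>t = 0\<close> is not used.\<close>

definition decreasing_rearrangement :: "(real \<Rightarrow> complex) \<Rightarrow> real \<Rightarrow> real" where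
  "decreasing_rearrangement f t = Inf {s. 0 \<le> s \<and> distribution_function f s \<le> t}"

definition LlogL_norm :: "(real \<Rightarrow> complex) \<Rightarrow> ennreal" where
  "LlogL_norm f =
     (\<integral>\<^sup>+ t\<in>{0<..<2}. ennreal (decreasing_rearrangement f t * ln (2 * exp 1 / t)) \<partial>lborel)"

definition LlogL :: "(real \<Rightarrow> complex) set" where
  "LlogL = {f \<in> borel_measurable \<mu>. LlogL_norm f < \<infinity>}"

text \<open>For \<^term>\<open>f \<in> L1\<close> the limit exists for almost every \<^term>\<open>t\<close> in the interval; elsewhere
  \<^const>\<open>Lim\<close> yields an unspecified fixed value.\<close>

definition finite_Hilbert_transform :: "(real \<Rightarrow> complex) \<Rightarrow> real \<Rightarrow> complex" where
  "finite_Hilbert_transform f t =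
     Lim (at_right 0) (\<lambda>\<epsilon>. complex_of_real (1 / pi) *
       ((LBINT x:{-1<..<t - \<epsilon>}. f x / complex_of_real (x - t)) +
        (LBINT x:{t + \<epsilon><..<1}. f x / complex_of_real (x - t))))"

definition order_bounded_in :: "(real \<Rightarrow> complex) set \<Rightarrow> (real \<Rightarrow> complex) set \<Rightarrow> bool" where
  "order_bounded_in X F \<longleftrightarrow> F \<subseteq> X \<and>
     (\<exists>h :: real \<Rightarrow> real. (\<lambda>x. complex_of_real (h x)) \<in> X \<and> (AE x in \<mu>. 0 \<le> h x) \<and>
        (\<forall>f\<in>F. AE x in \<mu>. cmod (f x) \<le> h x))"

definition order_bounded_operator ::
  "(real \<Rightarrow> complex) set \<Rightarrow> (real \<Rightarrow> complex) set \<Rightarrow>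
     ((real \<Rightarrow> complex) \<Rightarrow> (real \<Rightarrow> complex)) \<Rightarrow> bool" where
  "order_bounded_operator X Y A \<longleftrightarrow>
     (\<forall>F. order_bounded_in X F \<longrightarrow> order_bounded_in Y (A ` F))"

end

theory Submission
  imports Defs
begin

text \<open>Bounded functions lie in \<open>L log L\<close>, so the indicators \<open>f\<^sub>a\<close> of \<open>(-\<infinity>, a)\<close>, with \<open>a\<close> a rational
  point of \<open>(-1,1)\<close>, form an order bounded set: all of them are dominated by the constant \<open>1\<close>. For
  \<open>-1 < t < a < 1\<close> the singular contributions on the two sides of \<open>t\<close> cancel and the finite
  Hilbert transform of \<open>f\<^sub>a\<close> at \<open>t\<close> is \<open>ln ((a - t) / (1 + t)) / \<pi>\<close>, which tends to \<open>-\<infinity>\<close> as \<open>a\<close>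
  decreases to \<open>t\<close>. As there are only countably many \<open>a\<close>, an order bound of the transforms would
  have to dominate all of them simultaneously at almost every \<open>t\<close>, and hence be infinite there.\<close>

lemma space_\<mu>: "space \<mu> = {-1<..<1}"
  by (simp add: \<mu>_def space_restrict_space)

lemma LlogL_weight_integral_finite:
  "(\<integral>\<^sup>+ t\<in>{0<..<2}. ennreal (ln (2 * exp 1 / t)) \<partial>lborel) < \<infinity>"
proof -
  \<comment> \<open>Since \<open>ln y \<le> 2 * sqrt y\<close>, the weight is dominated by a multiple of \<open>1 / sqrt t\<close>.\<close>
  define c :: real where "c = 2 * sqrt (2 * exp 1)"
  have c: "c \<ge> 0"
    by (simp add: c_def)
  have bound: "ln (2 * exp 1 / t) \<le> c / sqrt t" if "0 < t" for t :: real
  proof -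
    have "0 \<le> 2 * exp 1 / t"
      using that by simp
    from ln_sqrt[OF this] have "ln (2 * exp 1 / t) = 2 * ln (sqrt (2 * exp 1 / t))"
      by linarith
    also have "\<dots> \<le> 2 * sqrt (2 * exp 1 / t)"
      using ln_le_minus_one[of "sqrt (2 * exp 1 / t)"] that by simp
    finally show ?thesis
      by (simp add: c_def real_sqrt_divide)
  qed
  have int: "((\<lambda>t. c / sqrt t) has_integral (2 * c * sqrt 2 - 2 * c * sqrt 0)) {0..2}"
  proof (rule fundamental_theorem_of_calculus_interior)
    fix t :: real
    assume "t \<in> {0<..<2}"
    then show "((\<lambda>t. 2 * c * sqrt t) has_vector_derivative c / sqrt t) (at t)"
      unfolding has_real_derivative_iff_has_vector_derivative[symmetric]
      by (auto intro!: derivative_eq_intros simp: field_simps)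
  qed (auto intro!: continuous_intros)
  have "(\<integral>\<^sup>+ t\<in>{0<..<2}. ennreal (ln (2 * exp 1 / t)) \<partial>lborel)
      \<le> (\<integral>\<^sup>+ t\<in>{0..2}. ennreal (c / sqrt t) \<partial>lborel)"
    using bound by (intro nn_integral_mono) (auto simp: indicator_def intro!: ennreal_leI)
  also have "\<dots> = ennreal (2 * c * sqrt 2 - 2 * c * sqrt 0)"
    using c by (intro nn_integral_has_integral_lebesgue'[OF _ int]) auto
  also have "\<dots> < \<infinity>"
    by simp
  finally show ?thesis .
qed

text \<open>A function bounded by \<open>1\<close> has decreasing rearrangement at most \<open>1\<close>, so its norm is at most the
  integral of the logarithmic weight.\<close>

lemma bounded_by_one_in_LlogL:
  assumes meas: "f \<in> borel_measurable \<mu>" and le: "\<And>x. x \<in> space \<mu> \<Longrightarrow> cmod (f x) \<le> 1"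
  shows "f \<in> LlogL"
proof -
  have "decreasing_rearrangement f t \<le> 1" if "0 < t" for t
  proof -
    have "{x \<in> space \<mu>. 1 < cmod (f x)} = {}"
      using le by (auto simp: not_less)
    then have "distribution_function f 1 = 0"
      unfolding distribution_function_def by (simp only: measure_empty)
    then show ?thesis
      unfolding decreasing_rearrangement_def
      using that by (intro cInf_lower bdd_belowI[of _ 0]) auto
  qed
  moreover have "0 \<le> ln (2 * exp 1 / t)" if "0 < t" "t < 2" for t :: real
  proof -
    have "t \<le> 2 * exp 1"
      using that one_le_exp_iff[of "1::real"] by linarith
    then show ?thesis
      using that by (intro ln_ge_zero) simp
  qed
  ultimately have "decreasing_rearrangement f t * ln (2 * exp 1 / t) \<le> ln (2 * exp 1 / t)"
    if "0 < t" "t < 2" for t :: real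
    using mult_right_mono[of "decreasing_rearrangement f t" 1 "ln (2 * exp 1 / t)"] that by simp
  then have "LlogL_norm f \<le> (\<integral>\<^sup>+ t\<in>{0<..<2}. ennreal (ln (2 * exp 1 / t)) \<partial>lborel)"
    unfolding LlogL_norm_def
    by (intro nn_integral_mono) (auto simp: indicator_def intro!: ennreal_leI)
  then show ?thesis
    using meas LlogL_weight_integral_finite by (auto simp: LlogL_def)
qed

text \<open>The logarithm on \<^typ>\<open>real\<close> is even, hence an antiderivative of the reciprocal on both half
  lines; the same formula below therefore serves on either side of the singularity.\<close>

lemma DERIV_ln_nonzero:
  fixes x :: real
  assumes "x \<noteq> 0"
  shows "(ln has_real_derivative 1 / x) (at x)"
proof (cases "0 < x")
  case True
  then show ?thesis
    by (rule DERIV_ln_divide)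
next
  case False
  then have "((\<lambda>y. ln (- y)) has_real_derivative 1 / x) (at x)"
    using assms by (auto intro!: derivative_eq_intros)
  then show ?thesis
    by (simp add: ln_minus)
qed

lemma integral_reciprocal_shift:
  fixes a b t :: real
  assumes "a < b" and "t \<notin> {a..b}"
  shows "(LBINT x:{a<..<b}. 1 / complex_of_real (x - t)) =
    complex_of_real (ln (b - t) - ln (a - t))"
proof -
  have deriv: "((\<lambda>x. complex_of_real (ln (x - t))) has_vector_derivative
      1 / complex_of_real (x - t)) (at x within {a..b})" if "x \<in> {a..b}" for x
  proof -
    have "x - t \<noteq> 0"
      using assms that by auto
    then have "((\<lambda>x. ln (x - t)) has_real_derivative 1 / (x - t) * 1) (at x)"
      by (intro DERIV_chain2[OF DERIV_ln_nonzero]) (auto intro!: derivative_eq_intros)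
    then have "((\<lambda>x. ln (x - t)) has_real_derivative 1 / (x - t)) (at x within {a..b})"
      by (simp add: has_field_derivative_at_within)
    from has_vector_derivative_of_real[OF this, where ?'a = complex] show ?thesis
      by simp
  qed
  have "(LBINT x=a..b. 1 / complex_of_real (x - t)) =
      complex_of_real (ln (b - t)) - complex_of_real (ln (a - t))"
    using assms deriv by (intro interval_integral_FTC_finite continuous_intros) auto
  then show ?thesis
    using assms by (simp add: interval_integral_Ioo)
qed

lemma finite_Hilbert_transform_indicator:
  fixes a t :: real
  assumes "-1 < t" "t < a" "a < 1"
  shows "finite_Hilbert_transform (indicator {..<a}) t =
    complex_of_real (ln ((a - t) / (1 + t)) / pi)"
proof -
  let ?I = "\<lambda>\<epsilon>. (LBINT x:{-1<..<t - \<epsilon>}. indicator {..<a} x / complex_of_real (x - t)) +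
    (LBINT x:{t + \<epsilon><..<1}. indicator {..<a} x / complex_of_real (x - t))"
  have val: "?I \<epsilon> = complex_of_real (ln ((a - t) / (1 + t)))"
    if "0 < \<epsilon>" "\<epsilon> < min (a - t) (1 + t)" for \<epsilon>
  proof -
    have "(LBINT x:{-1<..<t - \<epsilon>}. indicator {..<a} x / complex_of_real (x - t)) =
        (LBINT x:{-1<..<t - \<epsilon>}. 1 / complex_of_real (x - t))"
      using that assms by (intro set_lebesgue_integral_cong) auto
    also have "\<dots> = complex_of_real (ln \<epsilon> - ln (1 + t))"
      using that assms ln_minus[of \<epsilon>] ln_minus[of "1 + t"]
      by (subst integral_reciprocal_shift) auto
    finally have left: "(LBINT x:{-1<..<t - \<epsilon>}. indicator {..<a} x / complex_of_real (x - t)) =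
      complex_of_real (ln \<epsilon> - ln (1 + t))" .
    have "(LBINT x:{t + \<epsilon><..<1}. indicator {..<a} x / complex_of_real (x - t)) =
        (LBINT x:{t + \<epsilon><..<a}. 1 / complex_of_real (x - t))"
      unfolding set_lebesgue_integral_def
      using assms by (intro Bochner_Integration.integral_cong refl) (simp split: split_indicator)
    also have "\<dots> = complex_of_real (ln (a - t) - ln \<epsilon>)"
      using that assms by (subst integral_reciprocal_shift) auto
    finally show ?thesis
      using left assms by (simp add: ln_div)
  qed
  have "eventually (\<lambda>\<epsilon>. \<epsilon> \<in> {0<..<min (a - t) (1 + t)}) (at_right 0)"
    using assms by (intro eventually_at_right_real) auto
  then have "eventually (\<lambda>\<epsilon>. complex_of_real (1 / pi) * ?I \<epsilon> =
      complex_of_real (ln ((a - t) / (1 + t)) / pi)) (at_right 0)"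
    by eventually_elim (subst val, auto)
  then have "((\<lambda>\<epsilon>. complex_of_real (1 / pi) * ?I \<epsilon>) \<longlongrightarrow>
      complex_of_real (ln ((a - t) / (1 + t)) / pi)) (at_right 0)"
    by (rule tendsto_eventually)
  then show ?thesis
    unfolding finite_Hilbert_transform_def by (intro tendsto_Lim) simp_all
qed

lemma indicator_transforms_unbounded:
  fixes t C :: real
  assumes "-1 < t" "t < 1"
  obtains a where "a \<in> \<rat>" "-1 < a" "a < 1"
    "C < cmod (finite_Hilbert_transform (indicator {..<a}) t)"
proof -
  \<comment> \<open>The second bound on \<open>a - t\<close> makes \<open>ln ((a - t) / (1 + t)) < - pi * C\<close>, the first one \<open>a < 1\<close>.\<close>
  define d where "d = min (1 - t) ((1 + t) * exp (- pi * C))"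
  have "t < t + d"
    using assms by (simp add: d_def)
  then obtain a where a: "a \<in> \<rat>" "t < a" "a < t + d"
    using Rats_dense_in_real by blast
  have "a < 1" and less: "(a - t) / (1 + t) < exp (- pi * C)"
    using a(3) assms by (auto simp: d_def field_simps)
  have "0 < (a - t) / (1 + t)"
    using a assms by simp
  with less have "ln ((a - t) / (1 + t)) < ln (exp (- pi * C))"
    by (subst ln_less_cancel_iff) simp_all
  then have "pi * C < - ln ((a - t) / (1 + t))"
    by simp
  also have "\<dots> \<le> \<bar>ln ((a - t) / (1 + t))\<bar>"
    by simp
  finally have "C < \<bar>ln ((a - t) / (1 + t)) / pi\<bar>"
    by (simp add: abs_divide less_divide_eq mult.commute)
  then have "C < cmod (finite_Hilbert_transform (indicator {..<a}) t)"
    using finite_Hilbert_transform_indicator[of t a] assms a \<open>a < 1\<close>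
    by (simp only: norm_of_real)
  then show thesis
    using that a \<open>a < 1\<close> assms by auto
qed

theorem theorem4p4: "\<not> order_bounded_operator LlogL L1 finite_Hilbert_transform"
proof
  assume bdd: "order_bounded_operator LlogL L1 finite_Hilbert_transform"
  define A :: "real set" where "A = \<rat> \<inter> {-1<..<1}"
  define F :: "(real \<Rightarrow> complex) set" where "F = (\<lambda>a. indicator {..<a}) ` A"
  have "(indicator {..<a} :: real \<Rightarrow> complex) \<in> borel_measurable \<mu>" for a
    unfolding \<mu>_def by (intro measurable_restrict_space1) simp
  then have "F \<subseteq> LlogL"
    by (auto simp: F_def indicator_def intro!: bounded_by_one_in_LlogL)
  moreover have "(\<lambda>x. complex_of_real 1) \<in> LlogL"
    by (intro bounded_by_one_in_LlogL) auto
  ultimately have "order_bounded_in LlogL F"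
    unfolding order_bounded_in_def
    by (intro conjI exI[of _ "\<lambda>_. 1"]) (auto simp: F_def indicator_def)
  with bdd have "order_bounded_in L1 (finite_Hilbert_transform ` F)"
    by (simp add: order_bounded_operator_def)
  then obtain h :: "real \<Rightarrow> real" where
    "\<And>a. a \<in> A \<Longrightarrow> AE t in \<mu>. cmod (finite_Hilbert_transform (indicator {..<a}) t) \<le> h t"
    by (auto simp: order_bounded_in_def F_def)
  moreover have "countable A"
    by (simp add: A_def countable_rat countable_Int1)
  ultimately have "AE t in \<mu>. \<forall>a\<in>A. cmod (finite_Hilbert_transform (indicator {..<a}) t) \<le> h t"
    by (simp add: AE_ball_countable)
  moreover have "\<not> (\<forall>a\<in>A. cmod (finite_Hilbert_transform (indicator {..<a}) t) \<le> h t)"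
    if "t \<in> space \<mu>" for t
  proof -
    obtain a where "a \<in> A" "h t < cmod (finite_Hilbert_transform (indicator {..<a}) t)"
      using \<open>t \<in> space \<mu>\<close> indicator_transforms_unbounded[of t "h t"]
      unfolding A_def space_\<mu> by (metis IntI greaterThanLessThan_iff)
    then show ?thesis
      by (meson not_le)
  qed
  ultimately have "AE t in \<mu>. False"
    by (auto elim!: AE_mp intro!: AE_I2)
  moreover have "emeasure \<mu> (space \<mu>) = 2"
    by (simp add: space_\<mu>) (simp add: \<mu>_def emeasure_restrict_space)
  ultimately show False
    by (simp add: AE_iff_measurable[OF sets.top])
qed

end
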